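(* Let $(X,\mu)$ and $(Y,\nu)$ be strong generalized topological spaces and let $f:(X,\mu)\to(Y,\nu)$ be a surjective mapping. Then the following conditions are equivalent. (1) $f$ is a $g$-quotient mapping. (2) For each subset $F$ of $Y$, if $f^{-1}(F)$ is a $\mu$-closed subset of $(X,\mu)$, then $F$ is a $\nu$-closed subset of $(Y,\nu)$.
   Context: A generalized topological space is a pair $(X,\mu)$ where $X$ is a set and $\mu$ is a family of subsets of $X$ such that $\emptyset\in\mu$ and any union of elements of $\mu$ belongs to $\mu$ (intersections are not required to belong to $\mu$). It is strong if $X\in\mu$. A set $B\subseteq X$ is $\mu$-open if $B\in\mu$, and $\mu$-closed if $X\setminus B\in\mu$. No continuity of $f$ is assumed. The mapping $f$ is $g$-quotient if for each $V\subseteq Y$, $f^{-1}(V)\in\mu$ implies $V\in\nu$. *)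

theory Defs
  imports Main
begin

definition gen_top :: "'a set \<Rightarrow> 'a set set \<Rightarrow> bool" where
  "gen_top X \<mu> \<longleftrightarrow> \<mu> \<subseteq> Pow X \<and> {} \<in> \<mu> \<and> (\<forall>\<U>. \<U> \<subseteq> \<mu> \<longrightarrow> \<Union>\<U> \<in> \<mu>)"

definition strong_gen_top :: "'a set \<Rightarrow> 'a set set \<Rightarrow> bool" where
  "strong_gen_top X \<mu> \<longleftrightarrow> gen_top X \<mu> \<and> X \<in> \<mu>"

definition g_closed :: "'a set \<Rightarrow> 'a set set \<Rightarrow> 'a set \<Rightarrow> bool" where
  "g_closed X \<mu> B \<longleftrightarrow> B \<subseteq> X \<and> X - B \<in> \<mu>"

(* Maps are total HOL functions used only on the carrier X, so the preimage
   of V is f -` V \<inter> X. Continuity is not part of the notion. *)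
definition g_quotient ::
  "'a set \<Rightarrow> 'a set set \<Rightarrow> 'b set \<Rightarrow> 'b set set \<Rightarrow> ('a \<Rightarrow> 'b) \<Rightarrow> bool" where
  "g_quotient X \<mu> Y \<nu> f \<longleftrightarrow> (\<forall>V. V \<subseteq> Y \<longrightarrow> f -` V \<inter> X \<in> \<mu> \<longrightarrow> V \<in> \<nu>)"

end

theory Submission
  imports Defs
begin

text \<open>
  Preimages commute with complements, because \<open>f\<close> maps \<open>X\<close> into \<open>Y\<close>. Hence \<open>V \<mapsto> Y - V\<close>,
  an involution on the subsets of \<open>Y\<close>, turns the condition on open preimages into the
  condition on closed preimages and back.
\<close>

lemma vimage_Diff_on:
  assumes "f ` X \<subseteq> Y"
  shows "f -` (Y - B) \<inter> X = X - (f -` B \<inter> X)"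
  using assms by auto

theorem theorem3:
  fixes X :: "'a set" and \<mu> :: "'a set set"
    and Y :: "'b set" and \<nu> :: "'b set set"
    and f :: "'a \<Rightarrow> 'b"
  assumes "strong_gen_top X \<mu>"
    and "strong_gen_top Y \<nu>"
    and "f ` X = Y"
  shows "g_quotient X \<mu> Y \<nu> f \<longleftrightarrow>
    (\<forall>F. F \<subseteq> Y \<longrightarrow> g_closed X \<mu> (f -` F \<inter> X) \<longrightarrow> g_closed Y \<nu> F)"
proof -
  have preimage_compl: "f -` (Y - B) \<inter> X = X - (f -` B \<inter> X)" for B
    using assms(3) by (intro vimage_Diff_on) simp
  show ?thesis
  proof
    assume quotient: "g_quotient X \<mu> Y \<nu> f"
    show "\<forall>F. F \<subseteq> Y \<longrightarrow> g_closed X \<mu> (f -` F \<inter> X) \<longrightarrow> g_closed Y \<nu> F"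
    proof (intro allI impI)
      fix F assume "F \<subseteq> Y" and "g_closed X \<mu> (f -` F \<inter> X)"
      then have "f -` (Y - F) \<inter> X \<in> \<mu>"
        unfolding preimage_compl g_closed_def by blast
      with quotient have "Y - F \<in> \<nu>"
        unfolding g_quotient_def by blast
      with \<open>F \<subseteq> Y\<close> show "g_closed Y \<nu> F"
        unfolding g_closed_def by blast
    qed
  next
    assume closed: "\<forall>F. F \<subseteq> Y \<longrightarrow> g_closed X \<mu> (f -` F \<inter> X) \<longrightarrow> g_closed Y \<nu> F"
    show "g_quotient X \<mu> Y \<nu> f"
      unfolding g_quotient_def
    proof (intro allI impI)
      fix V assume "V \<subseteq> Y" and "f -` V \<inter> X \<in> \<mu>"
      moreover have "X - (f -` (Y - V) \<inter> X) = f -` V \<inter> X"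
        unfolding preimage_compl by blast
      ultimately have "g_closed X \<mu> (f -` (Y - V) \<inter> X)"
        unfolding g_closed_def by simp
      with closed have "g_closed Y \<nu> (Y - V)"
        by blast
      with \<open>V \<subseteq> Y\<close> show "V \<in> \<nu>"
        unfolding g_closed_def by (simp add: double_diff)
    qed
  qed
qed

end
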